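(* Let $n\ge 2$ be an integer, let $d_1=1,d_2,\dots,d_b$ be all the proper divisors of $n$ (positive divisors smaller than $n$), and let $G_n$ be an arbitrary subgroup of $\mathbb{Z}_n^{\times}$ (under multiplication modulo $n$). Then the collection of sets consisting of $\{0\}$ together with all the sets belonging to the partitions $$\mathbb{Z}_n^{\times}/G_n,\ \ \mathbb{Z}_n^{(d_2)}/G_{n/d_2},\ \ \dots,\ \ \mathbb{Z}_n^{(d_b)}/G_{n/d_b}$$ is a family of confusable sets of $\mathbb{Z}_n$, with randomizer $\gamma$ uniform over $\mathcal{S}^*=G_n$.
   Context: $\mathbb{Z}_n=\{0,1,\dots,n-1\}$ is the ring of integers modulo $n$. For a proper divisor $d$ of $n$, $\mathbb{Z}_n^{(d)}=\{a\in\mathbb{Z}_n:\gcd(a,n)=d\}$; in particular $\mathbb{Z}_n^{\times}=\mathbb{Z}_n^{(1)}$ is the multiplicative group of integers modulo $n$. One has $\mathbb{Z}_n^{(d)}=d\times\mathbb{Z}_{n/d}^{\times}=\{d a: a\in \mathbb{Z}_{n/d}^\times\}$. For a subgroup $G_n$ of $\mathbb{Z}_n^{\times}$ and a proper divisor $d$ of $n$, $G_{n/d}$ denotes the set $\{g \bmod (n/d): g\in G_n\}$, which is a subgroup of $\mathbb{Z}_{n/d}^{\times}$ under multiplication modulo $n/d$. The partition $\mathbb{Z}_n^{(d)}/G_{n/d}$ of $\mathbb{Z}_n^{(d)}$ is the one obtained by partitioning $\mathbb{Z}_{n/d}^{\times}$ into the cosets of $G_{n/d}$ and multiplying each coset by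 $d$: its members are the sets $d\times C=\{d c: c\in C\}\subset\mathbb{Z}_n$, where $C$ ranges over the cosets of $G_{n/d}$ in $\mathbb{Z}_{n/d}^{\times}$, with elements represented in $\{0,\dots,n/d-1\}$. For $d=1$ this is the partition $\mathbb{Z}_n^\times/G_n$ of $\mathbb{Z}_n^\times$ into cosets of $G_n$. Confusable sets and randomizer: sets $\mathcal{S}_0,\mathcal{S}_1,\mathcal{S}_2,\dots$ are called confusable sets of $\mathbb{Z}_n$ with randomizer $\gamma$ if they form a partition of $\mathbb{Z}_n$ and $\gamma$ is a random variable, uniform over a set $\mathcal{S}^*\subset\mathbb{Z}_n$, such that for every $i$ and every $s\in\mathcal{S}_i$, the random variable $\gamma\times s$ (product modulo $n$) is uniform over $\mathcal{S}_i$. *)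

theory Defs
  imports "HOL-Probability.Probability_Mass_Function" "HOL-Number_Theory.Residues"
begin

abbreviation unit_group :: "int \<Rightarrow> int monoid" where
  "unit_group n \<equiv> units_of (residue_ring n)"

definition proper_divisors :: "int \<Rightarrow> int set" where
  "proper_divisors n = {d. 0 < d \<and> d < n \<and> d dvd n}"

definition reduce_subgroup :: "int set \<Rightarrow> int \<Rightarrow> int set" where
  "reduce_subgroup G m = (\<lambda>g. g mod m) ` G"

text \<open>
  The partition of the residues having greatest common divisor \<open>d\<close> with \<open>n\<close>: for a proper
  divisor \<open>d\<close> and coset elements represented in \<open>{0..n div d - 1}\<close>, the products \<open>d * c\<close> lie
  in \<open>{0..n - 1}\<close>, so that no reduction modulo \<open>n\<close> is needed. Left and right cosets
  coincide because the group is commutative.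
\<close>

definition scaled_cosets :: "int \<Rightarrow> int set \<Rightarrow> int \<Rightarrow> int set set" where
  "scaled_cosets n G d =
     (\<lambda>C. (\<lambda>c. d * c) ` C) ` (rcosets\<^bsub>unit_group (n div d)\<^esub> (reduce_subgroup G (n div d)))"

text \<open>
  The uniform law makes sense only on a finite nonempty set; on other sets \<open>pmf_of_set\<close> is
  unspecified, hence the first two conjuncts.
\<close>

definition uniform_over :: "'w measure \<Rightarrow> ('w \<Rightarrow> int) \<Rightarrow> int set \<Rightarrow> bool" where
  "uniform_over M X A \<longleftrightarrow>
     finite A \<and> A \<noteq> {} \<and> X \<in> measurable M (count_space UNIV) \<and>
     distr M (count_space UNIV) X = measure_pmf (pmf_of_set A)"

definition confusable_sets ::
    "int \<Rightarrow> int set set \<Rightarrow> 'w measure \<Rightarrow> ('w \<Rightarrow> int) \<Rightarrow> int set \<Rightarrow> bool" where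
  "confusable_sets n \<S> M \<gamma> S' \<longleftrightarrow>
     partition_on (carrier (residue_ring n)) \<S> \<and>
     prob_space M \<and> S' \<subseteq> carrier (residue_ring n) \<and> uniform_over M \<gamma> S' \<and>
     (\<forall>S\<in>\<S>. \<forall>s\<in>S. uniform_over M (\<lambda>\<omega>. \<gamma> \<omega> \<otimes>\<^bsub>residue_ring n\<^esub> s) S)"

end

theory Submission
  imports Defs
begin

text \<open>
  Since \<open>d * (g * a mod (n div d)) = g * (d * a) mod n\<close>, the scaled coset of \<open>a\<close> is the orbit of
  \<open>d * a\<close> under multiplication by \<open>G\<close>. As \<open>d\<close> and \<open>a\<close> vary, \<open>d * a\<close> runs through all nonzero
  residues, so the family is the set of all \<open>G\<close>-orbits in the ring. Orbits partition it, and the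
  orbit map \<open>g \<mapsto> g * s\<close> has fibres of equal size, so it carries the uniform law on \<open>G\<close> to the
  uniform law on the orbit.
\<close>

text \<open>Counting \<open>A\<close> fibre by fibre gives \<open>card A = card (f\<close> A) *
  k\<open>, so every point of the image receives mass\<close>k / card A\<open>, which is\<close>1 /
  card (f \<open>A)\<close> after cancelling \<open>k\<close>.\<close>

lemma map_pmf_of_set_equal_fibres:
  assumes "finite A" "A \<noteq> {}"
    and fibres: "\<And>x. x \<in> A \<Longrightarrow> card {y \<in> A. f y = f x} = k"
  shows "map_pmf f (pmf_of_set A) = pmf_of_set (f ` A)"
proof (rule pmf_eqI)
  fix z
  have fibre: "A \<inter> f -` {z} = {y \<in> A. f y = z}"
    by auto
  have "card A = (\<Sum>z\<in>f ` A. card {y \<in> A. f y = z})"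
    using card_eq_sum sum.image_gen[OF assms(1), of "\<lambda>_. 1::nat" f] by simp
  also have "\<dots> = card (f ` A) * k"
    using fibres by (subst sum.cong[where h = "\<lambda>_. k"]) auto
  finally have card_A: "card A = card (f ` A) * k" .
  have "card A > 0"
    using assms by (simp add: card_gt_0_iff)
  then have "k > 0"
    using card_A by (metis gr0I mult_0_right)
  have "pmf (map_pmf f (pmf_of_set A)) z = card {y \<in> A. f y = z} / card A"
    using assms by (simp add: pmf_map measure_pmf_of_set fibre)
  also have "\<dots> = pmf (pmf_of_set (f ` A)) z"
  proof (cases "z \<in> f ` A")
    case True
    then have "card {y \<in> A. f y = z} = k"
      using fibres by auto
    then show ?thesis
      using True assms card_A \<open>k > 0\<close> by simp
  next
    case False
    then have "{y \<in> A. f y = z} = {}"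
      by auto
    then show ?thesis
      using False assms by simp
  qed
  finally show "pmf (map_pmf f (pmf_of_set A)) z = pmf (pmf_of_set (f ` A)) z" .
qed

text \<open>Reduces a claim about random variables on \<open>M\<close> to an identity between finite
  laws, because the law of the composite is the pushforward by \<open>f\<close> of the law of
  \<open>X\<close>.\<close>

lemma uniform_over_map:
  assumes "uniform_over M X A" "map_pmf f (pmf_of_set A) = pmf_of_set (f ` A)"
  shows "uniform_over M (\<lambda>\<omega>. f (X \<omega>)) (f ` A)"
proof -
  have X: "X \<in> measurable M (count_space UNIV)"
    and law: "distr M (count_space UNIV) X = measure_pmf (pmf_of_set A)"
    using assms(1) by (auto simp: uniform_over_def)
  have f: "f \<in> measurable (count_space UNIV) (count_space UNIV)"
    by simp
  have "distr M (count_space UNIV) (\<lambda>\<omega>. f (X \<omega>)) =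
      distr (distr M (count_space UNIV) X) (count_space UNIV) f"
    by (subst distr_distr[OF f X]) (simp add: comp_def)
  also have "\<dots> = measure_pmf (pmf_of_set (f ` A))"
    by (simp add: law map_pmf_rep_eq flip: assms(2))
  finally show ?thesis
    using assms(1) measurable_compose[OF X f] by (auto simp: uniform_over_def)
qed

context monoid
begin

text \<open>Restates the subgroup properties with the operations of the surrounding monoid, since
  \<open>H\<close> will act on all of \<open>carrier G\<close>, including elements that are not
  units.\<close>

lemma subgroup_units_facts:
  assumes "subgroup H (units_of G)"
  shows "H \<subseteq> carrier G" "\<one> \<in> H" "\<And>g h. g \<in> H \<Longrightarrow> h \<in> H \<Longrightarrow> g \<otimes> h \<in> H"
    and "\<And>g. g \<in> H \<Longrightarrow> \<exists>h\<in>H. h \<otimes> g = \<one> \<and> g \<otimes> h = \<one>"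
proof -
  interpret U: group "units_of G"
    by (rule units_group)
  interpret H: subgroup H "units_of G"
    by (rule assms)
  show "H \<subseteq> carrier G"
    using H.subset by (auto simp: units_of_carrier)
  show "\<one> \<in> H"
    using H.one_closed by (simp add: units_of_one)
  show "g \<otimes> h \<in> H" if "g \<in> H" "h \<in> H" for g h
    using H.m_closed[OF that] by (simp add: units_of_mult)
  show "\<exists>h\<in>H. h \<otimes> g = \<one> \<and> g \<otimes> h = \<one>" if "g \<in> H" for g
    using that H.m_inv_closed[OF that] U.l_inv[of g] U.r_inv[of g] H.mem_carrier[OF that]
    by (auto simp: units_of_mult units_of_one)
qed

lemma r_coset_conv_image: "H #> s = (\<lambda>h. h \<otimes> s) ` H"
  by (auto simp: r_coset_def)

text \<open>Only the acting elements are inverted, never \<open>s\<close>, so the argument covers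
  zero divisors. With \<open>t = g \<otimes> s\<close> and \<open>g'\<close> inverse to
  \<open>g\<close>, one has \<open>h \<otimes> t = (h \<otimes> g) \<otimes> s\<close> and
  \<open>h \<otimes> s = (h \<otimes> g') \<otimes> t\<close>.\<close>

lemma orbit_eq:
  assumes H: "subgroup H (units_of G)" and s: "s \<in> carrier G" and t: "t \<in> H #> s"
  shows "H #> t = H #> s"
proof -
  note H_facts = subgroup_units_facts[OF H]
  obtain g where g: "g \<in> H" "t = g \<otimes> s"
    using t by (auto simp: r_coset_def)
  obtain g' where g': "g' \<in> H" "g' \<otimes> g = \<one>"
    using H_facts(4)[OF g(1)] by auto
  show ?thesis
  proof
    show "H #> t \<subseteq> H #> s"
    proof
      fix x assume "x \<in> H #> t"
      then obtain h where h: "h \<in> H" "x = h \<otimes> t"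
        by (auto simp: r_coset_def)
      have "x = (h \<otimes> g) \<otimes> s"
        using g h s H_facts(1) by (simp add: m_assoc subset_iff)
      then show "x \<in> H #> s"
        using H_facts(3)[OF h(1) g(1)] by (auto simp: r_coset_conv_image)
    qed
    show "H #> s \<subseteq> H #> t"
    proof
      fix x assume "x \<in> H #> s"
      then obtain h where h: "h \<in> H" "x = h \<otimes> s"
        by (auto simp: r_coset_def)
      have "(h \<otimes> g') \<otimes> t = h \<otimes> ((g' \<otimes> g) \<otimes> s)"
        using g(1) g'(1) h(1) s H_facts(1) unfolding g(2)
        by (simp add: m_assoc subset_iff)
      then have "(h \<otimes> g') \<otimes> t = x"
        using g' h s by simp
      then show "x \<in> H #> t"
        using H_facts(3)[OF h(1) g'(1)] by (auto simp: r_coset_conv_image)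
    qed
  qed
qed

lemma mem_orbit:
  assumes "subgroup H (units_of G)" "s \<in> carrier G"
  shows "s \<in> H #> s"
  using subgroup_units_facts(2)[OF assms(1)] assms(2)
  by (force simp: r_coset_conv_image)

text \<open>Two orbits with a common point both equal the orbit of that point, and each element lies
  in its own orbit because \<one> is in \<open>H\<close>.\<close>

lemma partition_on_orbits:
  assumes H: "subgroup H (units_of G)"
  shows "partition_on (carrier G) ((\<lambda>s. H #> s) ` carrier G)"
proof (rule partition_onI)
  show "\<Union> ((\<lambda>s. H #> s) ` carrier G) = carrier G"
    using mem_orbit[OF H] subgroup_units_facts(1)[OF H]
    by (auto simp: r_coset_conv_image)
  show "disjnt p q"
    if pq: "p \<in> (\<lambda>s. H #> s) ` carrier G" "q \<in> (\<lambda>s. H #> s) ` carrier G" "p \<noteq> q" for p q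
  proof -
    obtain s t where "s \<in> carrier G" "t \<in> carrier G" "p = H #> s" "q = H #> t"
      using pq by auto
    then show ?thesis
      using orbit_eq[OF H] pq(3) unfolding disjnt_iff by metis
  qed
  show "{} \<notin> (\<lambda>s. H #> s) ` carrier G"
    using mem_orbit[OF H] by auto
qed

text \<open>The fibre through \<open>g\<close> is the translate by \<open>g\<close> of the
  stabilizer of \<open>s\<close>, so all fibres have the size of the stabilizer.\<close>

lemma map_pmf_of_set_orbit:
  assumes H: "subgroup H (units_of G)" and "finite H" and s: "s \<in> carrier G"
  shows "map_pmf (\<lambda>h. h \<otimes> s) (pmf_of_set H) = pmf_of_set ((\<lambda>h. h \<otimes> s) ` H)"
proof (rule map_pmf_of_set_equal_fibres)
  note H_facts = subgroup_units_facts[OF H]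
  show "finite H" "H \<noteq> {}"
    using assms H_facts by auto
  fix g assume g: "g \<in> H"
  then obtain g' where g': "g' \<in> H" "g' \<otimes> g = \<one>" "g \<otimes> g' = \<one>"
    using H_facts(4) by blast
  have carr: "h \<in> carrier G" if "h \<in> H" for h
    using that H_facts(1) by auto
  have cancel: "g' \<otimes> (g \<otimes> x) = x" "g \<otimes> (g' \<otimes> x) = x" if "x \<in> carrier G" for x
    using g g' carr that by (simp_all flip: m_assoc)
  \<comment> \<open>If \<open>h \<otimes> s = g \<otimes> s\<close>, then
    \<open>g' \<otimes> h\<close> fixes \<open>s\<close>; multiplication by \<open>g\<close> leads
    back.\<close>
  have "bij_betw (\<lambda>h. g' \<otimes> h) {h \<in> H. h \<otimes> s = g \<otimes> s} {h \<in> H. h \<otimes> s = s}"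
    by (rule bij_betw_byWitness[where f' = "\<lambda>h. g \<otimes> h"])
      (use g g' s H_facts(3) carr cancel in \<open>auto simp: m_assoc\<close>)
  then show "card {h \<in> H. h \<otimes> s = g \<otimes> s} = card {h \<in> H. h \<otimes> s = s}"
    by (rule bij_betw_same_card)
qed

end

lemma scaled_cosets_eq_orbits:
  assumes d: "d \<in> proper_divisors n"
  shows "scaled_cosets n H d =
    (\<lambda>a. H #>\<^bsub>residue_ring n\<^esub> (d * a)) ` {a. 0 < a \<and> a < n div d \<and> coprime a (n div d)}"
proof -
  define m where "m = n div d"
  have n: "n = d * m" and "0 < d" "d < n"
    using d by (auto simp: proper_divisors_def m_def)
  \<comment> \<open>Here \<open>d < n\<close> matters: the excluded divisor \<open>d = n\<close>
    would give the trivial ring, and its place in the family is taken by the block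
    \<open>{0}\<close>.\<close>
  have "m > 1"
    using \<open>0 < d\<close> \<open>d < n\<close> mult_less_cancel_left_pos[of d 1 m] n by simp
  interpret residues m "residue_ring m"
    by unfold_locales (rule \<open>m > 1\<close>)
  \<comment> \<open>Scaling by \<open>d\<close> turns reduction modulo \<open>m\<close> into
    reduction modulo \<open>d * m = n\<close>, which absorbs the inner reduction of \<open>g\<close>
    modulo \<open>m\<close>.\<close>
  have coset: "(\<lambda>c. d * c) ` (reduce_subgroup H m #>\<^bsub>units_of (residue_ring m)\<^esub> a) =
      H #>\<^bsub>residue_ring n\<^esub> (d * a)" for a
  proof -
    have "d * (g mod m * a mod m) = g * (d * a) mod n" for g
      by (simp only: n mod_mult_left_eq mult_mod_right mult.left_commute)
    then show ?thesis
      by (simp add: r_coset_def reduce_subgroup_def units_of_def residue_ring_def image_UN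
          UNION_singleton_eq_range image_image)
  qed
  have "carrier (units_of (residue_ring m)) = {a. 0 < a \<and> a < m \<and> coprime a m}"
    by (simp add: units_of_carrier res_units_eq)
  then show ?thesis
    unfolding scaled_cosets_def RCOSETS_def m_def[symmetric]
    by (simp add: UNION_singleton_eq_range image_image coset)
qed

text \<open>Classifies a nonzero residue \<open>s\<close> by \<open>d = gcd s n\<close>: the
  cofactor of \<open>s\<close> is then coprime to \<open>n div d\<close>, and \<open>d\<close> is
  proper because it divides \<open>s\<close>, which is positive and below \<open>n\<close>.\<close>

lemma nonzero_residues_eq_scaled_units:
  fixes n :: int
  assumes "n > 0"
  shows "{0<..<n} =
    (\<Union>d\<in>proper_divisors n. (\<lambda>a. d * a) ` {a. 0 < a \<and> a < n div d \<and> coprime a (n div d)})"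
proof (intro equalityI subsetI)
  fix s assume s: "s \<in> {0<..<n}"
  define d where "d = gcd s n"
  have "d > 0" "d dvd s" "d dvd n"
    using s by (auto simp: d_def)
  moreover have "d < n"
    using s \<open>d dvd s\<close> zdvd_imp_le[of d s] by auto
  ultimately have "d \<in> proper_divisors n"
    by (simp add: proper_divisors_def)
  moreover have "coprime (s div d) (n div d)"
    using s unfolding d_def by (intro div_gcd_coprime) auto
  moreover obtain a m where "s = d * a" "n = d * m"
    using \<open>d dvd s\<close> \<open>d dvd n\<close> by (auto elim!: dvdE)
  ultimately show "s \<in> (\<Union>d\<in>proper_divisors n.
      (\<lambda>a. d * a) ` {a. 0 < a \<and> a < n div d \<and> coprime a (n div d)})"
    using s \<open>d > 0\<close> by (intro UN_I[of d] image_eqI[of _ _ a]) (auto simp: zero_less_mult_iff)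
next
  fix s assume "s \<in> (\<Union>d\<in>proper_divisors n.
      (\<lambda>a. d * a) ` {a. 0 < a \<and> a < n div d \<and> coprime a (n div d)})"
  then obtain d a where "d > 0" "d dvd n" "s = d * a" "0 < a" "a < n div d"
    by (auto simp: proper_divisors_def)
  then show "s \<in> {0<..<n}"
    by (auto elim!: dvdE)
qed

theorem theorem3:
  fixes n :: int and G :: "int set" and M :: "'w measure" and \<gamma> :: "'w \<Rightarrow> int"
  assumes "n \<ge> 2"
    and "subgroup G (unit_group n)"
    and "prob_space M"
    and "uniform_over M \<gamma> G"
  shows "confusable_sets n
           (insert {0} (\<Union>d\<in>proper_divisors n. scaled_cosets n G d)) M \<gamma> G"
proof -
  let ?R = "residue_ring n"
  interpret residues n ?R
    by unfold_locales (use assms(1) in simp)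
  note G = assms(2)
  have "finite G" "G \<noteq> {}"
    using assms(4) by (auto simp: uniform_over_def)
  \<comment> \<open>This makes the extra block \<open>{0}\<close> an orbit too, so the whole family
    consists of orbits.\<close>
  have zero_orbit: "G #>\<^bsub>?R\<^esub> 0 = {0}"
    using \<open>G \<noteq> {}\<close> by (auto simp: r_coset_def res_mult_eq)
  have carrier: "carrier ?R = insert 0 {0<..<n}"
    using assms(1) by (auto simp: res_carrier_eq)
  have "(\<Union>d\<in>proper_divisors n. scaled_cosets n G d) = (\<lambda>s. G #>\<^bsub>?R\<^esub> s) ` {0<..<n}"
    using assms(1)
    by (simp add: nonzero_residues_eq_scaled_units image_UN image_image scaled_cosets_eq_orbits)
  then have orbits: "insert {0} (\<Union>d\<in>proper_divisors n. scaled_cosets n G d) =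
      (\<lambda>s. G #>\<^bsub>?R\<^esub> s) ` carrier ?R"
    by (simp add: carrier zero_orbit)
  \<comment> \<open>The block is given as the orbit of \<open>s\<close>, while the multiplier is an
    arbitrary member \<open>t\<close>. Uniformity is obtained on the orbit of \<open>t\<close>,
    which is the same set by \<open>orbit_eq\<close>.\<close>
  have "uniform_over M (\<lambda>\<omega>. \<gamma> \<omega> \<otimes>\<^bsub>?R\<^esub> t) (G #>\<^bsub>?R\<^esub> s)"
    if s: "s \<in> carrier ?R" and t: "t \<in> G #>\<^bsub>?R\<^esub> s" for s t
  proof -
    have "t \<in> carrier ?R"
      using s t subgroup_units_facts(1)[OF G] by (auto simp: r_coset_conv_image)
    then have "uniform_over M (\<lambda>\<omega>. \<gamma> \<omega> \<otimes>\<^bsub>?R\<^esub> t) ((\<lambda>g. g \<otimes>\<^bsub>?R\<^esub> t) ` G)"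
      by (intro uniform_over_map[OF assms(4)] map_pmf_of_set_orbit[OF G \<open>finite G\<close>])
    then show ?thesis
      by (simp only: orbit_eq[OF G s t] flip: r_coset_conv_image)
  qed
  then show ?thesis
    unfolding confusable_sets_def orbits
    using partition_on_orbits[OF G] subgroup_units_facts(1)[OF G] assms(3,4) by blast
qed

end
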